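(* Let $n\ge 1$ be an integer and let $(X,\|\cdot\|)$ be a real normed space of dimension $d\ge n$ which satisfies property (G). Then the $n$-dual space of $(X,\|\cdot,\ldots,\cdot\|_G)$, normed by $\|\cdot\|_{n,n}$, is $\left(B_{\mathrm{as}}(X,X^{(n-1)}),\|\cdot\|_G\right)$. Here the identification is the following: for every bounded multilinear $n$-functional $f$ on $(X,\|\cdot,\ldots,\cdot\|_G)$ the formula $$(u_f(z))(x_1,\ldots,x_{n-1}) = f(x_1,\ldots,x_{n-1},z)\qquad (x_1,\ldots,x_{n-1},z\in X)$$ defines an element $u_f\in B_{\mathrm{as}}(X,X^{(n-1)})$, and the map $f\mapsto u_f$ is an isometric linear bijection from the $n$-dual space of $(X,\|\cdot,\ldots,\cdot\|_G)$ onto $\left(B_{\mathrm{as}}(X,X^{(n-1)}),\|\cdot\|_G\right)$.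
   Context: Let $X$ be a real normed space with norm $\|\cdot\|$ (its dimension may be infinite). Multilinear functionals and $k$-dual spaces of $(X,\|\cdot\|)$: for $k\ge 1$, a $k$-functional on $X$ is a function $f:X^k\to\mathbb{R}$; it is multilinear if it is linear in each variable separately, and bounded on $(X,\|\cdot\|)$ if there is $K>0$ with $|f(x_1,\ldots,x_k)|\le K\|x_1\|\cdots\|x_k\|$ for all $x_1,\ldots,x_k\in X$. $X^{(k)}$ is the vector space of all bounded multilinear $k$-functionals on $(X,\|\cdot\|)$ with norm $\|f\|_{k,1}:=\sup_{x_1,\ldots,x_k\ne 0}\frac{|f(x_1,\ldots,x_k)|}{\|x_1\|\cdots\|x_k\|}$. In particular $X^{(1)}$ is the usual dual space. By convention $X^{(0)}:=\mathbb{R}$ with the absolute value as norm; when $n=1$, $(u(z))(x_1,\ldots,x_{n-1})$ means the real number $u(z)$. Gähler $n$-norm: for $x_1,\ldots,x_n\in X$, $$\|x_1,\ldots,x_n\|_G:=\sup\left\{\left|\det[f_j(x_i)]_{i,j}\right| : f_1,\ldots,f_n\in X^{(1)},\ \|f_i\|\le 1\right\}.$$ It vanishes exactly when $x_1,\ldots,x_n$ are linearly dependent. $n$-dual space of $(X,\|\cdot,\ldots,\cdot\|_G)$: an $n$-functional $f$ is bounded on $(X,\|\cdot,\ldots,\cdot\|_G)$ if there is $K>0$ with $|f(x_1,\ldots,x_n)|\le K\|x_1,\ldots,x_n\|_G$ for all $x_1,\ldots,x_n\in X$. The $n$-dual space of $(X,\|\cdot,\ldots,\cdot\|_G)$ is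 the vector space of all multilinear $n$-functionals bounded on $(X,\|\cdot,\ldots,\cdot\|_G)$, with the norm $$\|f\|_{n,n}:=\sup_{\|x_1,\ldots,x_n\|_G\ne 0}\frac{|f(x_1,\ldots,x_n)|}{\|x_1,\ldots,x_n\|_G}.$$ Property (G): define $g:X^2\to\mathbb{R}$ by $g(x,y):=\frac{\|x\|}{2}\left(\tau_-(x,y)+\tau_+(x,y)\right)$, where $\tau_\pm(x,y):=\lim_{t\to\pm 0}t^{-1}(\|x+ty\|-\|x\|)$ (one-sided limits at $0$). $X$ satisfies property (G) if, for every $x\in X$, the map $y\mapsto g(x,y)$ is linear. Antisymmetric operators: $B(X,X^{(n-1)})$ is the space of bounded linear operators from $X$ to $X^{(n-1)}$. An element $u\in B(X,X^{(n-1)})$ is antisymmetric if for all $x_1,\ldots,x_n\in X$ and all permutations $\sigma$ of $\{1,\ldots,n\}$, $$(u(x_n))(x_1,\ldots,x_{n-1})=\operatorname{sgn}(\sigma)\,(u(x_{\sigma(n)}))(x_{\sigma(1)},\ldots,x_{\sigma(n-1)}).$$ $B_{\mathrm{as}}(X,X^{(n-1)})$ is the subspace of antisymmetric elements, and for $u$ in it $$\|u\|_G:=\sup_{\|x_1,\ldots,x_n\|_G\neq 0}\frac{|(u(x_n))(x_1,\ldots,x_{n-1})|}{\|x_1,\ldots,x_n\|_G}.$$ *)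

theory Defs
  imports
    "HOL-Analysis.Bounded_Linear_Function"
    "Jordan_Normal_Form.Determinant"
begin

text \<open>
  The space \<open>X\<close> is the whole type \<open>'a\<close>. Tuples are indexed from 0: the tuple \<open>(x\<^sub>1, \<dots>, x\<^sub>k)\<close> is
  represented by the values \<open>x 0, \<dots>, x (k - 1)\<close> of a sequence \<open>x :: nat \<Rightarrow> 'a\<close>. A function on the
  \<open>k\<close>-th power of \<open>X\<close> is a function on sequences that ignores all entries from index \<open>k\<close> on, so that
  equality and the vector space operations of functionals are the pointwise ones. For \<open>k = 0\<close>
  these are the constant functions, that is, the real numbers.
\<close>

definition k_functional :: "nat \<Rightarrow> ((nat \<Rightarrow> 'a) \<Rightarrow> real) \<Rightarrow> bool" where
  "k_functional k f \<longleftrightarrow> (\<forall>x y. (\<forall>i<k. x i = y i) \<longrightarrow> f x = f y)"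

definition multilinear :: "nat \<Rightarrow> ((nat \<Rightarrow> 'a::real_vector) \<Rightarrow> real) \<Rightarrow> bool" where
  "multilinear k f \<longleftrightarrow> k_functional k f \<and> (\<forall>i<k. \<forall>x. linear (\<lambda>y. f (x(i := y))))"

definition k_dual :: "nat \<Rightarrow> ((nat \<Rightarrow> 'a::real_normed_vector) \<Rightarrow> real) set" where
  "k_dual k = {f. multilinear k f \<and> (\<exists>K>0. \<forall>x. \<bar>f x\<bar> \<le> K * (\<Prod>i<k. norm (x i)))}"

definition k_dual_norm :: "nat \<Rightarrow> ((nat \<Rightarrow> 'a::real_normed_vector) \<Rightarrow> real) \<Rightarrow> real" where
  "k_dual_norm k f = (SUP x\<in>{x. \<forall>i<k. x i \<noteq> 0}. \<bar>f x\<bar> / (\<Prod>i<k. norm (x i)))"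

text \<open>The functionals in the determinant range over the usual dual space \<open>'a \<Rightarrow>\<^sub>L real\<close>.\<close>

definition gahler_norm :: "nat \<Rightarrow> (nat \<Rightarrow> 'a::real_normed_vector) \<Rightarrow> real" where
  "gahler_norm n x =
     Sup {\<bar>det (mat n n (\<lambda>(i, j). blinfun_apply (f j) (x i)))\<bar> | f :: nat \<Rightarrow> ('a \<Rightarrow>\<^sub>L real).
            \<forall>j<n. norm (f j) \<le> 1}"

definition n_dual :: "nat \<Rightarrow> ((nat \<Rightarrow> 'a::real_normed_vector) \<Rightarrow> real) set" where
  "n_dual n = {f. multilinear n f \<and> (\<exists>K>0. \<forall>x. \<bar>f x\<bar> \<le> K * gahler_norm n x)}"

definition n_dual_norm :: "nat \<Rightarrow> ((nat \<Rightarrow> 'a::real_normed_vector) \<Rightarrow> real) \<Rightarrow> real" where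
  "n_dual_norm n f = (SUP x\<in>{x. gahler_norm n x \<noteq> 0}. \<bar>f x\<bar> / gahler_norm n x)"

definition tau_minus :: "'a::real_normed_vector \<Rightarrow> 'a \<Rightarrow> real" where
  "tau_minus x y = Lim (at_left 0) (\<lambda>t. inverse t * (norm (x + t *\<^sub>R y) - norm x))"

definition tau_plus :: "'a::real_normed_vector \<Rightarrow> 'a \<Rightarrow> real" where
  "tau_plus x y = Lim (at_right 0) (\<lambda>t. inverse t * (norm (x + t *\<^sub>R y) - norm x))"

definition g_functional :: "'a::real_normed_vector \<Rightarrow> 'a \<Rightarrow> real" where
  "g_functional x y = norm x / 2 * (tau_minus x y + tau_plus x y)"

definition property_G :: "'a::real_normed_vector itself \<Rightarrow> bool" where
  "property_G _ \<longleftrightarrow> (\<forall>x::'a. linear (g_functional x))"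

text \<open>
  Dimension (possibly infinite) at least \<open>n\<close>; the library's \<open>dim\<close> is 0 on infinite-dimensional
  spaces.
\<close>

definition dim_at_least :: "'a::real_vector itself \<Rightarrow> nat \<Rightarrow> bool" where
  "dim_at_least _ n \<longleftrightarrow>
     (\<exists>B :: 'a set. independent B \<and> span B = UNIV \<and> (infinite B \<or> n \<le> card B))"

text \<open>
  The bounded linear operators from \<open>X\<close> to \<open>k_dual k\<close>. As the operations of \<open>k_dual k\<close> are
  pointwise, linearity of \<open>u\<close> means linearity of \<open>z \<mapsto> u z x\<close> for every tuple \<open>x\<close>.
\<close>

definition bounded_ops ::
    "nat \<Rightarrow> ('a::real_normed_vector \<Rightarrow> (nat \<Rightarrow> 'a) \<Rightarrow> real) set" where
  "bounded_ops k =
     {u. (\<forall>z. u z \<in> k_dual k) \<and> (\<forall>x. linear (\<lambda>z. u z x)) \<and>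
         (\<exists>K. \<forall>z. k_dual_norm k (u z) \<le> K * norm z)}"

text \<open>
  With 0-based indices \<open>x\<^sub>n\<close> is \<open>x (n - 1)\<close>, and \<open>u (x (n - 1))\<close>, being an \<open>(n - 1)\<close>-functional,
  reads only the entries before it.
\<close>

definition antisymmetric ::
    "nat \<Rightarrow> ('a::real_normed_vector \<Rightarrow> (nat \<Rightarrow> 'a) \<Rightarrow> real) \<Rightarrow> bool" where
  "antisymmetric n u \<longleftrightarrow>
     (\<forall>x \<sigma>. \<sigma> permutes {..<n} \<longrightarrow>
        u (x (n - 1)) x = of_int (sign \<sigma>) * u (x (\<sigma> (n - 1))) (\<lambda>i. x (\<sigma> i)))"

definition B_as :: "nat \<Rightarrow> ('a::real_normed_vector \<Rightarrow> (nat \<Rightarrow> 'a) \<Rightarrow> real) set" where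
  "B_as n = {u \<in> bounded_ops (n - 1). antisymmetric n u}"

definition B_as_norm ::
    "nat \<Rightarrow> ('a::real_normed_vector \<Rightarrow> (nat \<Rightarrow> 'a) \<Rightarrow> real) \<Rightarrow> real" where
  "B_as_norm n u =
     (SUP x\<in>{x. gahler_norm n x \<noteq> 0}. \<bar>u (x (n - 1)) x\<bar> / gahler_norm n x)"

definition assoc_op ::
    "nat \<Rightarrow> ((nat \<Rightarrow> 'a) \<Rightarrow> real) \<Rightarrow> 'a \<Rightarrow> (nat \<Rightarrow> 'a) \<Rightarrow> real" where
  "assoc_op n f z x = f (x(n - 1 := z))"

end

theory Submission
  imports Defs
begin

text \<open>
  A functional that is bounded with respect to the Gaehler norm vanishes on tuples with a repeated
  entry, hence it is antisymmetric. Conversely, an alternating multilinear functional does not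
  change when a multiple of one entry is added to another one. Under property (G) the functionals
  \<open>y \<mapsto> g(x, y) / \<parallel>x\<parallel>\<close> have norm at most 1 and norm \<open>x\<close>, so that a Gram-Schmidt process with
  respect to \<open>g\<close> turns a tuple \<open>x\<close> into a tuple \<open>y\<close> with the same value under every
  alternating multilinear functional, in particular with the same Gaehler norm, for which the
  matrix \<open>g(y\<^sub>j, y\<^sub>i) / \<parallel>y\<^sub>j\<parallel>\<close> is triangular with diagonal \<open>\<parallel>y\<^sub>i\<parallel>\<close>. Thus the Gaehler norm of \<open>x\<close>
  is at least \<open>\<parallel>y\<^sub>1\<parallel> \<cdots> \<parallel>y\<^sub>n\<parallel>\<close>, and boundedness of the operator gives boundedness with respect to
  the Gaehler norm.
\<close>

section \<open>Alternating functionals\<close>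

text \<open>Vanishing on repeated entries is the form of antisymmetry that a bound by the Gaehler
  norm yields directly.\<close>

definition alternating :: "nat \<Rightarrow> ((nat \<Rightarrow> 'a) \<Rightarrow> real) \<Rightarrow> bool" where
  "alternating n f \<longleftrightarrow> (\<forall>x i j. i < n \<longrightarrow> j < n \<longrightarrow> i \<noteq> j \<longrightarrow> x i = x j \<longrightarrow> f x = 0)"

lemma multilinear_cong:
  assumes "multilinear n f" "\<And>i. i < n \<Longrightarrow> x i = y i"
  shows "f x = f y"
  using assms unfolding multilinear_def k_functional_def by blast

lemma multilinear_add:
  assumes "multilinear n f" "i < n"
  shows "f (x(i := a + b)) = f (x(i := a)) + f (x(i := b))"
  using assms linear_add[of "\<lambda>y. f (x(i := y))" a b] unfolding multilinear_def by blast

lemma multilinear_scale: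
  assumes "multilinear n f" "i < n"
  shows "f (x(i := c *\<^sub>R a)) = c * f (x(i := a))"
  using assms linear_cmul[of "\<lambda>y. f (x(i := y))" c a] unfolding multilinear_def by auto

lemma multilinear_zero:
  assumes "multilinear n f" "i < n" "x i = 0"
  shows "f x = 0"
  using multilinear_scale[OF assms(1,2), of x 0 0] assms(3)
  by (metis fun_upd_triv mult_zero_left scale_zero_left)

text \<open>By linearity in slot \<open>i\<close> the value changes by \<open>c\<close> times the
  value at a tuple with \<open>x j\<close> in both slots, which is zero.\<close>

lemma alternating_add_multiple:
  assumes "multilinear n f" "alternating n f" "i < n" "j < n" "i \<noteq> j"
  shows "f (x(i := x i + c *\<^sub>R x j)) = f x"
proof -
  have "f (x(i := x j)) = 0"
    using assms(2-5) unfolding alternating_def by (metis fun_upd_other fun_upd_same)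
  then show ?thesis
    using assms by (simp add: multilinear_add multilinear_scale)
qed

text \<open>Polarization: with \<open>x i + x j\<close> placed in both slots the value is zero, and
  of its four terms only the two mixed ones survive.\<close>

lemma alternating_transpose:
  assumes f: "multilinear n f" "alternating n f" and ij: "i < n" "j < n" "i \<noteq> j"
  shows "f (x \<circ> Transposition.transpose i j) = - f x"
proof -
  let ?g = "\<lambda>a b. f (x(i := a, j := b))"
  have zero: "?g a a = 0" for a
    using f(2) ij unfolding alternating_def by (metis fun_upd_other fun_upd_same)
  have add1: "?g (a + b) c = ?g a c + ?g b c" for a b c
    using multilinear_add[OF f(1) ij(1), of "x(j := c)" a b] ij by (simp add: fun_upd_twist)
  have add2: "?g c (a + b) = ?g c a + ?g c b" for a b c
    using multilinear_add[OF f(1) ij(2), of "x(i := c)" a b] by simp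
  have "?g (x j) (x i) = - ?g (x i) (x j)"
    using zero[of "x i + x j"] zero[of "x i"] zero[of "x j"] unfolding add1 add2 by linarith
  moreover have "x \<circ> Transposition.transpose i j = x(i := x j, j := x i)"
    using ij by (auto simp: Transposition.transpose_def fun_eq_iff)
  ultimately show ?thesis by simp
qed

lemma alternating_permute:
  assumes f: "multilinear n f" "alternating n f" and "\<sigma> permutes {..<n}"
  shows "f (x \<circ> \<sigma>) = of_int (sign \<sigma>) * f x"
  using assms(3) finite_lessThan[of n]
proof (induction arbitrary: x rule: permutes_induct)
  case id
  then show ?case by (simp add: sign_id)
next
  case (swap a b p)
  \<comment> \<open>The induction hypothesis is applied to the transposed tuple, which is why
    \<open>x\<close> is kept arbitrary.\<close>
  have "f (x \<circ> (Transposition.transpose a b \<circ> p)) = of_int (sign p) * f (x \<circ> Transposition.transpose a b)"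
    using swap.IH[of "x \<circ> Transposition.transpose a b"] by (simp only: comp_assoc)
  also have "f (x \<circ> Transposition.transpose a b) = - f x"
    using alternating_transpose[OF f] swap by auto
  also have "of_int (sign p) * - f x = of_int (- sign p) * f x"
    by simp
  also have "- sign p = sign (Transposition.transpose a b \<circ> p)"
  proof -
    have "permutation p" using swap permutes_imp_permutation[OF finite_lessThan] by blast
    then have "sign (Transposition.transpose a b \<circ> p) = sign (Transposition.transpose a b) * sign p"
      by (intro sign_compose permutation_swap_id)
    then show ?thesis using \<open>a \<noteq> b\<close> by (simp only: sign_swap_id if_False mult_minus1)
  qed
  finally show ?case .
qed

section \<open>The Gaehler norm\<close>

text \<open>For fixed \<open>h\<close> the determinant is itself an alternating multilinear
  functional of the tuple, so whatever preserves all such functionals preserves the Gaehler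
  norm.\<close>

definition det_functional :: "nat \<Rightarrow> (nat \<Rightarrow> 'a::real_normed_vector \<Rightarrow>\<^sub>L real) \<Rightarrow> (nat \<Rightarrow> 'a) \<Rightarrow> real"
  where "det_functional n h x = det (mat n n (\<lambda>(i, j). blinfun_apply (h j) (x i)))"

lemma det_functional_eq:
  "det_functional n h x =
     (\<Sum>p | p permutes {0..<n}. of_int (sign p) * (\<Prod>i = 0..<n. blinfun_apply (h (p i)) (x i)))"
proof -
  have "p i < n" if "p permutes {0..<n}" "i < n" for p i
    using that permutes_in_image[of p "{0..<n}" i] by simp
  then show ?thesis
    unfolding det_functional_def
    by (subst det_def'[of _ n]) (auto intro!: sum.cong prod.cong)
qed

lemma multilinear_det_functional: "multilinear n (det_functional n h)"
proof -
  have "linear (\<lambda>y. det_functional n h (x(i := y)))" if i: "i < n" for i x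
  proof -
    \<comment> \<open>In each Leibniz term only the factor with index \<open>i\<close> depends on
      \<open>y\<close>.\<close>
    have split: "(\<Prod>k = 0..<n. blinfun_apply (h (p k)) ((x(i := y)) k)) =
        blinfun_apply (h (p i)) y * (\<Prod>k \<in> {0..<n} - {i}. blinfun_apply (h (p k)) (x k))" for p y
      using i by (subst prod.remove[of _ i]) auto
    show ?thesis
      unfolding det_functional_eq split
      by (intro linearI)
        (simp_all add: blinfun.add_right blinfun.scaleR_right sum.distrib sum_distrib_left
          algebra_simps)
  qed
  then show ?thesis
    unfolding multilinear_def k_functional_def det_functional_eq by auto
qed

lemma alternating_det_functional: "alternating n (det_functional n h)"
  unfolding alternating_def
proof (intro allI impI)
  fix x :: "nat \<Rightarrow> 'a" and i j
  assume "i < n" "j < n" "i \<noteq> j" "x i = x j"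
  then show "det_functional n h x = 0"
    unfolding det_functional_def by (intro det_identical_rows[of _ n i j]) auto
qed

text \<open>The Leibniz formula has \<open>fact n\<close> terms, each at most the product of the
  norms. The bound also makes the supremum in the Gaehler norm finite.\<close>

lemma det_functional_bound:
  assumes "\<forall>j<n. norm (h j) \<le> 1"
  shows "\<bar>det_functional n h x\<bar> \<le> fact n * (\<Prod>i<n. norm (x i))"
proof -
  have "\<bar>of_int (sign p) * (\<Prod>i = 0..<n. blinfun_apply (h (p i)) (x i))\<bar> \<le> (\<Prod>i<n. norm (x i))"
    if p: "p permutes {0..<n}" for p
  proof -
    have "\<bar>blinfun_apply (h (p i)) (x i)\<bar> \<le> norm (x i)" if "i < n" for i
    proof -
      have "p i < n" using p that permutes_in_image[of p "{0..<n}" i] by simp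
      then show ?thesis
        using norm_blinfun[of "h (p i)" "x i"] assms
        by (smt (verit) mult_left_le_one_le norm_ge_zero real_norm_def)
    qed
    then show ?thesis
      by (auto simp: abs_mult abs_prod sign_def lessThan_atLeast0 intro!: prod_mono)
  qed
  then have "\<bar>det_functional n h x\<bar> \<le> (\<Sum>p | p permutes {0..<n}. \<Prod>i<n. norm (x i))"
    unfolding det_functional_eq by (intro order.trans[OF sum_abs] sum_mono) auto
  also have "\<dots> = fact n * (\<Prod>i<n. norm (x i))"
    by (simp add: card_permutations[of _ n])
  finally show ?thesis .
qed

lemma gahler_norm_eq: "gahler_norm n x = (SUP h\<in>{h. \<forall>j<n. norm (h j) \<le> 1}. \<bar>det_functional n h x\<bar>)"
  unfolding gahler_norm_def det_functional_def by (rule arg_cong[of _ _ Sup]) auto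

lemma gahler_norm_upper:
  assumes "\<forall>j<n. norm (h j) \<le> 1"
  shows "\<bar>det_functional n h x\<bar> \<le> gahler_norm n x"
  unfolding gahler_norm_eq using assms
  by (intro cSUP_upper bdd_aboveI2[where M = "fact n * (\<Prod>i<n. norm (x i))"])
    (auto intro: det_functional_bound)

lemma gahler_norm_least:
  assumes "\<And>h. \<forall>j<n. norm (h j) \<le> 1 \<Longrightarrow> \<bar>det_functional n h x\<bar> \<le> c"
  shows "gahler_norm n x \<le> c"
  \<comment> \<open>The zero functionals show that the supremum is over a nonempty set.\<close>
  unfolding gahler_norm_eq using assms by (intro cSUP_least) (auto intro: exI[of _ "\<lambda>_. 0"])

lemma gahler_norm_le_prod: "gahler_norm n x \<le> fact n * (\<Prod>i<n. norm (x i))"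
  by (intro gahler_norm_least det_functional_bound)

lemma gahler_norm_repeated:
  assumes "i < n" "j < n" "i \<noteq> j" "x i = x j"
  shows "gahler_norm n x \<le> 0"
proof (rule gahler_norm_least)
  show "\<bar>det_functional n h x\<bar> \<le> 0" for h
    using alternating_det_functional[of n h] assms unfolding alternating_def by simp
qed

lemma n_dual_alternating:
  assumes "f \<in> n_dual n"
  shows "alternating n f"
  unfolding alternating_def
proof (intro allI impI)
  fix x :: "nat \<Rightarrow> 'a" and i j
  assume "i < n" "j < n" "i \<noteq> j" "x i = x j"
  then have "gahler_norm n x \<le> 0" by (rule gahler_norm_repeated)
  moreover obtain K where "K > 0" "\<bar>f x\<bar> \<le> K * gahler_norm n x"
    using assms unfolding n_dual_def by blast
  ultimately show "f x = 0"
    by (smt (verit) mult_nonneg_nonpos)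
qed

section \<open>The functional g\<close>

text \<open>Convexity of the norm: \<open>x + s *\<^sub>R y\<close> is a convex combination of
  \<open>x\<close> and \<open>x + t *\<^sub>R y\<close> with weight \<open>s / t\<close>.\<close>

lemma norm_quotient_mono:
  fixes x y :: "'a::real_normed_vector"
  assumes "0 < s" "s \<le> t"
  shows "inverse s * (norm (x + s *\<^sub>R y) - norm x) \<le> inverse t * (norm (x + t *\<^sub>R y) - norm x)"
proof -
  have "x + s *\<^sub>R y = (1 - s / t) *\<^sub>R x + (s / t) *\<^sub>R (x + t *\<^sub>R y)"
    using assms by (simp add: algebra_simps)
  then have "norm (x + s *\<^sub>R y) \<le> (1 - s / t) * norm x + s / t * norm (x + t *\<^sub>R y)"
    using assms norm_triangle_ineq[of "(1 - s / t) *\<^sub>R x" "(s / t) *\<^sub>R (x + t *\<^sub>R y)"] by simp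
  then have "norm (x + s *\<^sub>R y) - norm x \<le> (inverse t * (norm (x + t *\<^sub>R y) - norm x)) * s"
    by (simp add: algebra_simps divide_inverse)
  then have "(norm (x + s *\<^sub>R y) - norm x) / s \<le> inverse t * (norm (x + t *\<^sub>R y) - norm x)"
    using assms by (simp only: pos_divide_le_eq)
  then show ?thesis by (simp only: divide_inverse mult.commute)
qed

lemma norm_quotient_bound:
  fixes x y :: "'a::real_normed_vector"
  assumes "t \<noteq> 0"
  shows "\<bar>inverse t * (norm (x + t *\<^sub>R y) - norm x)\<bar> \<le> norm y"
proof -
  have "\<bar>norm (x + t *\<^sub>R y) - norm x\<bar> \<le> \<bar>t\<bar> * norm y"
    using norm_triangle_ineq3[of "x + t *\<^sub>R y" x] by simp
  then have "\<bar>norm (x + t *\<^sub>R y) - norm x\<bar> / \<bar>t\<bar> \<le> norm y"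
    using assms by (simp add: divide_le_eq mult.commute)
  then show ?thesis by (simp only: abs_mult abs_inverse divide_inverse mult.commute)
qed

text \<open>The quotient is monotone in \<open>t > 0\<close> and bounded below, so it tends to its
  infimum.\<close>

lemma norm_quotient_tendsto_right:
  fixes x y :: "'a::real_normed_vector"
  shows "\<exists>L. ((\<lambda>t. inverse t * (norm (x + t *\<^sub>R y) - norm x)) \<longlongrightarrow> L) (at_right 0)"
proof -
  define q where "q t = inverse t * (norm (x + t *\<^sub>R y) - norm x)" for t :: real
  have bdd: "bdd_below (q ` {0<..})"
    using norm_quotient_bound[of _ x y] unfolding q_def
    by (intro bdd_belowI2[of _ "- norm y"]) (smt (verit) greaterThan_iff)
  have "(q \<longlongrightarrow> (INF t\<in>{0<..}. q t)) (at_right 0)"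
  proof (rule order_tendstoI)
    fix a assume "a < (INF t\<in>{0<..}. q t)"
    then have "a < q t" if "t > 0" for t
      using cINF_lower[OF bdd, of t] that by simp
    then show "\<forall>\<^sub>F t in at_right 0. a < q t"
      by (auto simp: eventually_at_right_less eventually_at_filter)
  next
    fix a assume "(INF t\<in>{0<..}. q t) < a"
    then obtain t0 where "t0 > 0" "q t0 < a"
      using cINF_less_iff[OF _ bdd, of a] by auto
    then have "q t < a" if "0 < t" "t < t0" for t
      using norm_quotient_mono[of t t0 x y] that unfolding q_def by simp
    then show "\<forall>\<^sub>F t in at_right 0. q t < a"
      using \<open>t0 > 0\<close> unfolding eventually_at_right_field by blast
  qed
  then show ?thesis unfolding q_def by blast
qed

text \<open>Replacing \<open>t\<close> by \<open>- t\<close> turns the quotient for \<open>y\<close>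
  into minus the quotient for \<open>- y\<close>.\<close>

lemma norm_quotient_tendsto_left:
  fixes x y :: "'a::real_normed_vector"
  shows "\<exists>L. ((\<lambda>t. inverse t * (norm (x + t *\<^sub>R y) - norm x)) \<longlongrightarrow> L) (at_left 0)"
proof -
  obtain L where "((\<lambda>t. inverse t * (norm (x + t *\<^sub>R (- y)) - norm x)) \<longlongrightarrow> L) (at_right 0)"
    using norm_quotient_tendsto_right[of x "- y"] by blast
  from tendsto_minus[OF this] show ?thesis
    unfolding filterlim_at_left_to_right[of _ _ "0::real"] by (intro exI[of _ "- L"]) simp
qed

text \<open>\<open>Lim\<close> is a definite description, so the bound on the quotients passes to
  \<open>tau_plus\<close> only through the existence of the limit.\<close>

lemma tau_plus_bound: "\<bar>tau_plus x y\<bar> \<le> norm y"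
proof -
  let ?q = "\<lambda>t. inverse t * (norm (x + t *\<^sub>R y) - norm x)"
  obtain L where L: "(?q \<longlongrightarrow> L) (at_right 0)"
    using norm_quotient_tendsto_right by blast
  have "\<forall>\<^sub>F t in at_right 0. \<bar>?q t\<bar> \<le> norm y"
    unfolding eventually_at_filter by (intro always_eventually) (use norm_quotient_bound in blast)
  then have "\<bar>L\<bar> \<le> norm y"
    using tendsto_upperbound[OF tendsto_rabs[OF L]] by simp
  then show ?thesis
    using tendsto_Lim[OF _ L] unfolding tau_plus_def by simp
qed

lemma tau_minus_bound: "\<bar>tau_minus x y\<bar> \<le> norm y"
proof -
  let ?q = "\<lambda>t. inverse t * (norm (x + t *\<^sub>R y) - norm x)"
  obtain L where L: "(?q \<longlongrightarrow> L) (at_left 0)"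
    using norm_quotient_tendsto_left by blast
  have "\<forall>\<^sub>F t in at_left 0. \<bar>?q t\<bar> \<le> norm y"
    unfolding eventually_at_filter by (intro always_eventually) (use norm_quotient_bound in blast)
  then have "\<bar>L\<bar> \<le> norm y"
    using tendsto_upperbound[OF tendsto_rabs[OF L]] by simp
  then show ?thesis
    using tendsto_Lim[OF _ L] unfolding tau_minus_def by simp
qed

lemma norm_quotient_self:
  fixes x :: "'a::real_normed_vector"
  shows "\<forall>\<^sub>F t in at 0. norm x = inverse t * (norm (x + t *\<^sub>R x) - norm x)"
proof -
  have "norm x = inverse t * (norm (x + t *\<^sub>R x) - norm x)" if "t \<noteq> 0" "\<bar>t\<bar> < 1" for t :: real
  proof -
    \<comment> \<open>Here \<open>1 + t\<close> is positive, so it equals its absolute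
      value.\<close>
    have "norm (x + t *\<^sub>R x) = (1 + t) * norm x"
      using that norm_scaleR[of "1 + t" x] by (simp add: scaleR_add_left del: norm_scaleR)
    then show ?thesis using that by (simp add: algebra_simps)
  qed
  then show ?thesis
    unfolding eventually_at by (intro exI[of _ 1]) auto
qed

lemma g_functional_self: "g_functional x x = norm x * norm x"
proof -
  let ?q = "\<lambda>t. inverse t * (norm (x + t *\<^sub>R x) - norm x)"
  have "(?q \<longlongrightarrow> norm x) (at 0)"
    using Lim_transform_eventually[OF tendsto_const norm_quotient_self] .
  then have "(?q \<longlongrightarrow> norm x) (at_left 0)" "(?q \<longlongrightarrow> norm x) (at_right 0)"
    by (auto intro: tendsto_within_subset)
  then have "tau_minus x x = norm x" "tau_plus x x = norm x"
    unfolding tau_minus_def tau_plus_def by (auto intro!: tendsto_Lim)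
  then show ?thesis by (simp add: g_functional_def)
qed

lemma g_functional_bound: "\<bar>g_functional x y\<bar> \<le> norm x * norm y"
proof -
  have "\<bar>tau_minus x y + tau_plus x y\<bar> \<le> 2 * norm y"
    using tau_minus_bound[of x y] tau_plus_bound[of x y] by linarith
  then have "norm x / 2 * \<bar>tau_minus x y + tau_plus x y\<bar> \<le> norm x / 2 * (2 * norm y)"
    by (intro mult_left_mono) auto
  then show ?thesis by (simp add: g_functional_def abs_mult)
qed

section \<open>Gram-Schmidt with respect to g\<close>

text \<open>The invariant of the Gram-Schmidt steps. It covers the given functional and all
  \<open>det_functional n h\<close> at once.\<close>

definition alternating_equiv :: "nat \<Rightarrow> (nat \<Rightarrow> 'a::real_vector) \<Rightarrow> (nat \<Rightarrow> 'a) \<Rightarrow> bool" where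
  "alternating_equiv n x y \<longleftrightarrow> (\<forall>f. multilinear n f \<longrightarrow> alternating n f \<longrightarrow> f x = f y)"

text \<open>Only entry \<open>k\<close> is altered, by subtracting multiples of earlier entries one
  at a time. As \<open>g_functional\<close> need not be symmetric, the altered entry stays in the
  second argument, where property (G) gives linearity.\<close>

lemma g_orthogonalize_entry:
  fixes y :: "nat \<Rightarrow> 'a::real_normed_vector"
  assumes G: "property_G TYPE('a)" and k: "k < n" "m \<le> k"
    and orth: "\<And>i j. j < i \<Longrightarrow> i < k \<Longrightarrow> g_functional (y j) (y i) = 0"
  shows "\<exists>w. alternating_equiv n y (y(k := w)) \<and> (\<forall>j<m. g_functional (y j) w = 0)"
  using k(2)
proof (induction m)
  case 0
  then show ?case by (intro exI[of _ "y k"]) (simp add: alternating_equiv_def)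
next
  case (Suc m)
  obtain w where w: "alternating_equiv n y (y(k := w))" "\<And>j. j < m \<Longrightarrow> g_functional (y j) w = 0"
    using Suc.IH Suc_leD[OF Suc.prems] by blast
  \<comment> \<open>Chosen to make \<open>g_functional (y m) ?w\<close> vanish. If
    \<open>y m = 0\<close>, the division yields \<open>c = 0\<close> and
    \<open>g_functional (y m)\<close> is zero anyway.\<close>
  define c where "c = - g_functional (y m) w / g_functional (y m) (y m)"
  let ?w = "w + c *\<^sub>R y m"
  have lin: "linear (g_functional (y j))" for j
    using G unfolding property_G_def by blast
  have g: "g_functional (y j) ?w = g_functional (y j) w + c * g_functional (y j) (y m)" for j
    using linear_add[OF lin] linear_cmul[OF lin] by simp
  have "f (y(k := ?w)) = f (y(k := w))" if "multilinear n f" "alternating n f" for f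
    using alternating_add_multiple[OF that, of k m "y(k := w)" c] k(1) Suc.prems by simp
  then have "alternating_equiv n y (y(k := ?w))"
    using w(1) unfolding alternating_equiv_def by metis
  moreover have "g_functional (y j) ?w = 0" if "j < Suc m" for j
  proof (cases "j = m")
    case True
    show ?thesis
    proof (cases "y m = 0")
      case True
      then show ?thesis using \<open>j = m\<close> by (simp add: g_functional_def)
    next
      case False
      then have "g_functional (y m) (y m) \<noteq> 0" by (simp add: g_functional_self)
      then show ?thesis using \<open>j = m\<close> unfolding g by (simp add: c_def)
    qed
  next
    case False
    \<comment> \<open>For \<open>j < m\<close> the added multiple of \<open>y m\<close> does no
      harm, because \<open>y m\<close> is already orthogonal to \<open>y j\<close>.\<close>
    then show ?thesis using that w(2)[of j] orth[of j m] Suc.prems unfolding g by simp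
  qed
  ultimately show ?case by blast
qed

lemma g_orthogonalize:
  fixes x :: "nat \<Rightarrow> 'a::real_normed_vector"
  assumes G: "property_G TYPE('a)" and "k \<le> n"
  shows "\<exists>y. alternating_equiv n x y \<and>
    (\<forall>i j. j < i \<longrightarrow> i < k \<longrightarrow> g_functional (y j) (y i) = 0)"
  using assms(2)
proof (induction k)
  case 0
  then show ?case by (intro exI[of _ x]) (simp add: alternating_equiv_def)
next
  case (Suc k)
  then obtain y where y: "alternating_equiv n x y"
    "\<And>i j. j < i \<Longrightarrow> i < k \<Longrightarrow> g_functional (y j) (y i) = 0" by auto
  obtain w where w: "alternating_equiv n y (y(k := w))" "\<And>j. j < k \<Longrightarrow> g_functional (y j) w = 0"
    using g_orthogonalize_entry[of k n k y, OF G _ _ y(2)] Suc.prems by auto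
  have "alternating_equiv n x (y(k := w))"
    using y(1) w(1) unfolding alternating_equiv_def by metis
  \<comment> \<open>The relations obtained earlier involve only indices below \<open>k\<close>, so
    they survive the change of entry \<open>k\<close>.\<close>
  moreover have "g_functional ((y(k := w)) j) ((y(k := w)) i) = 0" if "j < i" "i < Suc k" for i j
    using that y(2) w(2) by auto
  ultimately show ?case by blast
qed

section \<open>Lower bounds for the Gaehler norm by products of norms\<close>

lemma gahler_norm_alternating_equiv:
  assumes "alternating_equiv n x y"
  shows "gahler_norm n x = gahler_norm n y"
  using assms multilinear_det_functional alternating_det_functional
  unfolding gahler_norm_eq alternating_equiv_def by metis

lemma prod_norm_le_gahler_norm:
  fixes y :: "nat \<Rightarrow> 'a::real_normed_vector"
  assumes G: "property_G TYPE('a)"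
    and orth: "\<And>i j. j < i \<Longrightarrow> i < n \<Longrightarrow> g_functional (y j) (y i) = 0"
  shows "(\<Prod>i<n. norm (y i)) \<le> gahler_norm n y"
proof -
  text \<open>If \<open>y j = 0\<close> then this is the zero functional, since \<open>g 0 z / 0 = 0\<close>.\<close>
  define h where "h j = Blinfun (\<lambda>z. g_functional (y j) z / norm (y j))" for j
  have bound: "\<bar>g_functional (y j) z / norm (y j)\<bar> \<le> norm z" for j z
    using g_functional_bound[of "y j" z]
    by (cases "y j = 0") (simp_all add: divide_le_eq mult.commute)
  have "bounded_linear (\<lambda>z. g_functional (y j) z / norm (y j))" for j
  proof -
    have "linear (g_functional (y j))"
      using G unfolding property_G_def by blast
    then show ?thesis
      using bound by (intro bounded_linear_intro[where K = 1])
        (auto simp: linear_add linear_cmul add_divide_distrib)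
  qed
  then have h: "blinfun_apply (h j) z = g_functional (y j) z / norm (y j)" for j z
    unfolding h_def by (simp add: bounded_linear_Blinfun_apply)
  have "norm (h j) \<le> 1" for j
    using bound by (intro norm_blinfun_bound) (auto simp: h)
  then have "\<bar>det_functional n h y\<bar> \<le> gahler_norm n y"
    by (intro gahler_norm_upper) simp
  moreover have "det_functional n h y = (\<Prod>i<n. norm (y i))"
  proof -
    let ?M = "mat n n (\<lambda>(i, j). blinfun_apply (h j) (y i))"
    \<comment> \<open>Rows belong to vectors and columns to functionals, so \<open>orth\<close>
      kills the entries below the diagonal.\<close>
    have "upper_triangular ?M"
      using orth by (auto simp: h)
    then have "det ?M = prod_list (diag_mat ?M)"
      by (rule det_upper_triangular[of _ n]) simp
    also have "\<dots> = (\<Prod>i<n. norm (y i))"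
      by (auto simp: prod_list_diag_prod h g_functional_self lessThan_atLeast0 intro!: prod.cong)
    finally show ?thesis unfolding det_functional_def .
  qed
  ultimately show ?thesis by linarith
qed

text \<open>Both \<open>f\<close> and the Gaehler norm take the same values at \<open>x\<close> and
  at its orthogonalization \<open>y\<close>, where the product of the norms is at most the Gaehler
  norm.\<close>

lemma alternating_in_n_dual:
  fixes f :: "(nat \<Rightarrow> 'a::real_normed_vector) \<Rightarrow> real"
  assumes G: "property_G TYPE('a)" and f: "multilinear n f" "alternating n f"
    and bound: "\<And>x. \<bar>f x\<bar> \<le> K * (\<Prod>i<n. norm (x i))" and "K > 0"
  shows "f \<in> n_dual n"
proof -
  have "\<bar>f x\<bar> \<le> K * gahler_norm n x" for x
  proof -
    obtain y where y: "alternating_equiv n x y"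
      "\<And>i j. j < i \<Longrightarrow> i < n \<Longrightarrow> g_functional (y j) (y i) = 0"
      using g_orthogonalize[OF G order.refl] by blast
    have "\<bar>f x\<bar> = \<bar>f y\<bar>"
      using y(1) f unfolding alternating_equiv_def by metis
    also have "\<dots> \<le> K * (\<Prod>i<n. norm (y i))" by (rule bound)
    also have "\<dots> \<le> K * gahler_norm n y"
      using prod_norm_le_gahler_norm[OF G y(2)] \<open>K > 0\<close> by simp
    finally show ?thesis
      using gahler_norm_alternating_equiv[OF y(1)] by simp
  qed
  then show ?thesis
    using f(1) \<open>K > 0\<close> unfolding n_dual_def by blast
qed

section \<open>The associated operator\<close>

text \<open>Boundedness comes from the estimate of the Gaehler norm by \<open>fact n\<close> times
  the product of the norms, antisymmetry from \<open>f\<close> being alternating.\<close>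

lemma assoc_op_in_B_as:
  fixes f :: "(nat \<Rightarrow> 'a::real_normed_vector) \<Rightarrow> real"
  assumes n: "n \<ge> 1" and nonzero: "\<exists>v::'a. v \<noteq> 0" and f: "f \<in> n_dual n"
  shows "assoc_op n f \<in> B_as n"
proof -
  have ml: "multilinear n f" using f unfolding n_dual_def by simp
  have alt: "alternating n f" using f by (rule n_dual_alternating)
  obtain K where K: "K > 0" "\<And>x. \<bar>f x\<bar> \<le> K * gahler_norm n x"
    using f unfolding n_dual_def by blast
  obtain m where m: "n = Suc m" using n by (cases n) auto
  define C where "C = K * fact n"
  have C: "C > 0" using K(1) unfolding C_def by simp
  have bound: "\<bar>assoc_op n f z x\<bar> \<le> C * norm z * (\<Prod>i<m. norm (x i))" for z x
  proof -
    have "\<bar>f (x(m := z))\<bar> \<le> K * (fact n * (\<Prod>i<n. norm ((x(m := z)) i)))"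
      using K(2)[of "x(m := z)"] gahler_norm_le_prod[of n "x(m := z)"] K(1)
      by (meson mult_left_mono less_imp_le order.trans)
    also have "(\<Prod>i<n. norm ((x(m := z)) i)) = norm z * (\<Prod>i<m. norm (x i))"
      by (simp add: m mult.commute)
    finally show ?thesis unfolding assoc_op_def m diff_Suc_1 C_def by (simp only: mult.assoc)
  qed
  have mlz: "multilinear m (assoc_op n f z)" for z
  proof -
    have "linear (\<lambda>y. f (x(i := y, m := z)))" if "i < m" for i x
    proof -
      have "linear (\<lambda>y. f ((x(m := z))(i := y)))"
        using ml that unfolding multilinear_def m by simp
      then show ?thesis using that by (simp add: fun_upd_twist)
    qed
    moreover have "f (x(m := z)) = f (y(m := z))" if "\<forall>i<m. x i = y i" for x y
      using that by (intro multilinear_cong[OF ml]) (auto simp: m less_Suc_eq)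
    ultimately show ?thesis
      unfolding multilinear_def k_functional_def assoc_op_def m by simp
  qed
  have "assoc_op n f z \<in> k_dual m" for z
  proof -
    \<comment> \<open>The summand 1 keeps the constant positive for \<open>z = 0\<close>, as
      \<open>k_dual\<close> demands.\<close>
    have "\<bar>assoc_op n f z x\<bar> \<le> (C * norm z + 1) * (\<Prod>i<m. norm (x i))" for x
      using bound[of z x] prod_nonneg[of "{..<m}" "\<lambda>i. norm (x i)"]
      by (simp add: distrib_right)
    moreover have "C * norm z + 1 > 0"
      using C by (simp add: add_nonneg_pos)
    ultimately show ?thesis
      using mlz unfolding k_dual_def by blast
  qed
  moreover have "linear (\<lambda>z. assoc_op n f z x)" for x
    using ml unfolding multilinear_def assoc_op_def by (simp add: m)
  moreover have "k_dual_norm m (assoc_op n f z) \<le> C * norm z" for z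
    unfolding k_dual_norm_def
  proof (rule cSUP_least)
    \<comment> \<open>A constant tuple with a nonzero value lies in this set.\<close>
    show "{x :: nat \<Rightarrow> 'a. \<forall>i<m. x i \<noteq> 0} \<noteq> {}"
      using nonzero by auto
    show "\<bar>assoc_op n f z x\<bar> / (\<Prod>i<m. norm (x i)) \<le> C * norm z"
      if "x \<in> {x. \<forall>i<m. x i \<noteq> 0}" for x
      using that bound[of z x] prod_pos[of "{..<m}" "\<lambda>i. norm (x i)"]
      by (simp add: divide_le_eq)
  qed
  ultimately have "assoc_op n f \<in> bounded_ops m"
    unfolding bounded_ops_def by blast
  moreover have "antisymmetric n (assoc_op n f)"
    unfolding antisymmetric_def
  proof (intro allI impI)
    fix x :: "nat \<Rightarrow> 'a" and \<sigma>
    assume "\<sigma> permutes {..<n}"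
    then have "f (x \<circ> \<sigma>) = of_int (sign \<sigma>) * f x"
      by (rule alternating_permute[OF ml alt])
    then have "f x = of_int (sign \<sigma>) * f (x \<circ> \<sigma>)"
      by (simp add: sign_def)
    moreover have "(\<lambda>i. x (\<sigma> i))(n - 1 := x (\<sigma> (n - 1))) = x \<circ> \<sigma>"
      by auto
    ultimately show "assoc_op n f (x (n - 1)) x =
        of_int (sign \<sigma>) * assoc_op n f (x (\<sigma> (n - 1))) (\<lambda>i. x (\<sigma> i))"
      by (simp add: assoc_op_def)
  qed
  ultimately show ?thesis by (simp add: B_as_def m)
qed

section \<open>From operators back to functionals\<close>

lemma bounded_ops_bound:
  fixes u :: "'a::real_normed_vector \<Rightarrow> (nat \<Rightarrow> 'a) \<Rightarrow> real"
  assumes "u \<in> bounded_ops m"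
  shows "\<exists>K>0. \<forall>z x. \<bar>u z x\<bar> \<le> K * norm z * (\<Prod>i<m. norm (x i))"
proof -
  obtain K where K: "\<And>z. k_dual_norm m (u z) \<le> K * norm z"
    using assms unfolding bounded_ops_def by blast
  have dual: "u z \<in> k_dual m" for z using assms unfolding bounded_ops_def by blast
  have "\<bar>u z x\<bar> \<le> (\<bar>K\<bar> + 1) * norm z * (\<Prod>i<m. norm (x i))" for z x
  proof (cases "\<forall>i<m. x i \<noteq> 0")
    case True
    let ?S = "{x :: nat \<Rightarrow> 'a. \<forall>i<m. x i \<noteq> 0}"
    have pos: "(\<Prod>i<m. norm (y i)) > 0" if "y \<in> ?S" for y
      using that by (intro prod_pos) auto
    obtain M where M: "\<And>y. \<bar>u z y\<bar> \<le> M * (\<Prod>i<m. norm (y i))"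
      using dual[of z] unfolding k_dual_def by blast
    \<comment> \<open>Membership of \<open>u z\<close> in \<open>k_dual m\<close> bounds the
      quotients, so that the real supremum \<open>k_dual_norm\<close> really dominates each of
      them.\<close>
    have "bdd_above ((\<lambda>x. \<bar>u z x\<bar> / (\<Prod>i<m. norm (x i))) ` ?S)"
      using M pos by (intro bdd_aboveI2[where M = M]) (simp add: pos_divide_le_eq)
    then have "\<bar>u z x\<bar> / (\<Prod>i<m. norm (x i)) \<le> k_dual_norm m (u z)"
      unfolding k_dual_norm_def using True by (intro cSUP_upper) auto
    also have "\<dots> \<le> K * norm z" by (rule K)
    also have "\<dots> \<le> (\<bar>K\<bar> + 1) * norm z" by (intro mult_right_mono) auto
    finally show ?thesis using pos[of x] True by (simp add: divide_le_eq)
  next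
    case False
    then have "u z x = 0"
      using dual[of z] multilinear_zero unfolding k_dual_def by blast
    then show ?thesis by (simp add: prod_nonneg)
  qed
  then show ?thesis by (intro exI[of _ "\<bar>K\<bar> + 1"]) auto
qed

text \<open>The preimage feeds the last entry to \<open>u\<close>. Antisymmetry makes it
  alternating, and the operator bound becomes a bound by the product of all \<open>n\<close>
  norms.\<close>

lemma B_as_imp_assoc_op:
  fixes u :: "'a::real_normed_vector \<Rightarrow> (nat \<Rightarrow> 'a) \<Rightarrow> real"
  assumes n: "n \<ge> 1" and G: "property_G TYPE('a)" and u: "u \<in> B_as n"
  shows "\<exists>f\<in>n_dual n. assoc_op n f = u"
proof -
  obtain m where m: "n = Suc m" using n by (cases n) auto
  have ops: "u \<in> bounded_ops m" and anti: "antisymmetric n u"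
    using u by (simp_all add: B_as_def m)
  have ml: "multilinear m (u z)" and lin: "linear (\<lambda>z. u z x)" for z x
    using ops unfolding bounded_ops_def k_dual_def by blast+
  define f where "f x = u (x m) x" for x
  \<comment> \<open>The functional \<open>u z\<close> reads only entries below
    \<open>m\<close>.\<close>
  have upd: "u z (x(m := w)) = u z x" for z w x
    by (rule multilinear_cong[OF ml]) simp
  have "multilinear n f"
    unfolding multilinear_def k_functional_def
  proof (intro conjI allI impI)
    fix x y :: "nat \<Rightarrow> 'a" assume "\<forall>i<n. x i = y i"
    then show "f x = f y"
      unfolding f_def m using multilinear_cong[OF ml, of x y] by simp
  next
    fix i x assume "i < n"
    show "linear (\<lambda>y. f (x(i := y)))"
    proof (cases "i = m")
      case True
      then show ?thesis using lin by (simp add: f_def upd)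
    next
      case False
      then have "linear (\<lambda>y. u (x m) (x(i := y)))"
        using ml \<open>i < n\<close> unfolding multilinear_def m by simp
      then show ?thesis using False by (simp add: f_def)
    qed
  qed
  moreover have "alternating n f"
    unfolding alternating_def
  proof (intro allI impI)
    fix x :: "nat \<Rightarrow> 'a" and i j
    assume ij: "i < n" "j < n" "i \<noteq> j" "x i = x j"
    let ?\<sigma> = "Transposition.transpose i j"
    have x: "x (?\<sigma> k) = x k" for k
      using ij by (simp add: Transposition.transpose_def)
    have "?\<sigma> permutes {..<n}"
      using ij by (intro permutes_swap_id) auto
    then have "u (x m) x = of_int (sign ?\<sigma>) * u (x (?\<sigma> m)) (\<lambda>i. x (?\<sigma> i))"
      using anti unfolding antisymmetric_def m diff_Suc_1 by blast
    \<comment> \<open>The transposition leaves the tuple unchanged and has sign -1, hence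
      \<open>f x = - f x\<close>.\<close>
    then show "f x = 0"
      using ij by (simp add: x sign_swap_id f_def)
  qed
  moreover obtain K where "K > 0" "\<And>z x. \<bar>u z x\<bar> \<le> K * norm z * (\<Prod>i<m. norm (x i))"
    using bounded_ops_bound[OF ops] by blast
  then have "\<bar>f x\<bar> \<le> K * (\<Prod>i<n. norm (x i))" for x
    by (simp add: f_def m mult.assoc mult.commute)
  ultimately have "f \<in> n_dual n"
    using \<open>K > 0\<close> by (intro alternating_in_n_dual[OF G])
  moreover have "assoc_op n f = u"
    by (intro ext) (simp add: assoc_op_def f_def m upd)
  ultimately show ?thesis by blast
qed

lemma dim_at_least_nonzero:
  assumes "dim_at_least TYPE('a::real_vector) n" "n \<ge> 1"
  shows "\<exists>v::'a. v \<noteq> 0"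
proof -
  obtain B :: "'a set" where "independent B" "infinite B \<or> n \<le> card B"
    using assms(1) unfolding dim_at_least_def by blast
  moreover from this have "B \<noteq> {}" using assms(2) by auto
  ultimately show ?thesis
    using dependent_zero by (metis ex_in_conv)
qed

theorem theorem4p5:
  fixes n :: nat
  assumes "n \<ge> 1"
    and "dim_at_least TYPE('a::real_normed_vector) n"
    and "property_G TYPE('a)"
  shows "(\<forall>f \<in> (n_dual n :: ((nat \<Rightarrow> 'a) \<Rightarrow> real) set). assoc_op n f \<in> B_as n)
    \<and> (\<forall>f \<in> (n_dual n :: ((nat \<Rightarrow> 'a) \<Rightarrow> real) set). \<forall>g \<in> n_dual n. \<forall>a b :: real.
          assoc_op n (\<lambda>x. a * f x + b * g x)
            = (\<lambda>z x. a * assoc_op n f z x + b * assoc_op n g z x))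
    \<and> (\<forall>f \<in> (n_dual n :: ((nat \<Rightarrow> 'a) \<Rightarrow> real) set).
          B_as_norm n (assoc_op n f) = n_dual_norm n f)
    \<and> bij_betw (assoc_op n) (n_dual n :: ((nat \<Rightarrow> 'a) \<Rightarrow> real) set) (B_as n)"
proof -
  have into: "assoc_op n f \<in> B_as n" if "f \<in> n_dual n" for f :: "(nat \<Rightarrow> 'a) \<Rightarrow> real"
    using assoc_op_in_B_as[OF assms(1) dim_at_least_nonzero[OF assms(2,1)] that] .
  \<comment> \<open>Inserting the last entry recovers \<open>f\<close>. This gives injectivity and
    turns both norms into the same supremum.\<close>
  have eval_last: "assoc_op n f (x (n - 1)) x = f x" for f :: "(nat \<Rightarrow> 'a) \<Rightarrow> real" and x
    by (simp add: assoc_op_def)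
  then have "inj_on (assoc_op n) (n_dual n :: ((nat \<Rightarrow> 'a) \<Rightarrow> real) set)"
    by (intro inj_onI ext) metis
  moreover have "assoc_op n ` n_dual n = (B_as n :: ('a \<Rightarrow> (nat \<Rightarrow> 'a) \<Rightarrow> real) set)"
    using into B_as_imp_assoc_op[OF assms(1,3)] by blast
  ultimately have "bij_betw (assoc_op n) (n_dual n :: ((nat \<Rightarrow> 'a) \<Rightarrow> real) set) (B_as n)"
    by (simp only: bij_betw_def)
  then show ?thesis
    using into eval_last by (simp only: B_as_norm_def n_dual_norm_def) (simp add: assoc_op_def fun_eq_iff)
qed

end
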